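(* Let $r\geq 0$ be a real number. Then the following holds. (1) Any finite quasimetric space has an $r$-minimal model, which is unique up to isometry. (2) Two finite quasimetric spaces are $r$-homotopy equivalent if and only if their $r$-minimal models are isometric. (3) Any finite quasimetric space $X$ has an $r$-deformation retract $A\subseteq X$ which is an $r$-minimal model of $X$.
   Context: A quasimetric space is a set $X$ with a map $d:X\times X\to[0,+\infty]$ such that $d(x,z)\leq d(x,y)+d(y,z)$ for all $x,y,z\in X$, and $d(x,y)=0$ if and only if $x=y$ ($d$ need not be symmetric and may take the value $+\infty$). A map $\varphi:X\to Y$ of quasimetric spaces is short if $d(\varphi(x),\varphi(x'))\leq d(x,x')$ for all $x,x'\in X$. An isometry is a distance-preserving bijection. The set $\mathrm{SMap}(X,Y)$ of short maps is a quasimetric space with $d(\varphi,\psi)=\sup_{x\in X} d(\varphi(x),\psi(x))$. For a real $r\ge 0$, $\sim_r$ denotes the smallest equivalence relation on the points of a quasimetric space such that $d(x,x')\le r$ implies $x\sim_r x'$. Two short maps $\varphi,\psi:X\to Y$ are $r$-homotopic, $\varphi\sim_r\psi$, if they are related by $\sim_r$ as points of $\mathrm{SMap}(X,Y)$. A short map $\varphi:X\to Y$ is an $r$-homotopy equivalence if there is a short map $\psi:Y\to X$ with $\psi\varphi\sim_r 1_X$ and $\varphi\psi\sim_r 1_Y$; in that case $X$ and $Y$ are called $r$-homotopy equivalent. A subset $A\subseteq X$ is regarded as a quasimetric space with the induced distance, with inclusion $\iota:A\to X$. It is a retract of $X$ if there is a short map $\rho:X\to A$ (a retraction) with $\rho\iota=1_A$;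 it is proper if $A\neq X$. It is an $r$-deformation retract if there is a retraction $\rho$ with $\iota\rho\sim_r 1_X$. A finite quasimetric space is $r$-minimal if it has no proper $r$-deformation retracts. An $r$-minimal model of a finite quasimetric space $X$ is an $r$-minimal finite quasimetric space $M$ that is $r$-homotopy equivalent to $X$. *)

theory Defs
  imports "HOL-Library.Extended_Nonnegative_Real" "HOL-Library.FuncSet"
begin

(* A quasimetric space is a carrier set X together with a distance function d; only the values
   of d on X matter. In particular a subset A of X with the induced distance is just A with
   the same d. *)

definition quasimetric_space :: "'a set \<Rightarrow> ('a \<Rightarrow> 'a \<Rightarrow> ennreal) \<Rightarrow> bool" where
  "quasimetric_space X d \<longleftrightarrow>
     (\<forall>x\<in>X. \<forall>y\<in>X. \<forall>z\<in>X. d x z \<le> d x y + d y z) \<and>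
     (\<forall>x\<in>X. \<forall>y\<in>X. d x y = 0 \<longleftrightarrow> x = y)"

(* Maps between carriers are extensional functions (constantly undefined off X), so that
   equality of maps is equality on X and SMap X Y is again a quasimetric space. *)

definition SMap ::
  "'a set \<Rightarrow> ('a \<Rightarrow> 'a \<Rightarrow> ennreal) \<Rightarrow> 'b set \<Rightarrow> ('b \<Rightarrow> 'b \<Rightarrow> ennreal) \<Rightarrow> ('a \<Rightarrow> 'b) set" where
  "SMap X dX Y dY = {f \<in> X \<rightarrow>\<^sub>E Y. \<forall>x\<in>X. \<forall>x'\<in>X. dY (f x) (f x') \<le> dX x x'}"

definition SMap_dist ::
  "'a set \<Rightarrow> ('b \<Rightarrow> 'b \<Rightarrow> ennreal) \<Rightarrow> ('a \<Rightarrow> 'b) \<Rightarrow> ('a \<Rightarrow> 'b) \<Rightarrow> ennreal" where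
  "SMap_dist X dY f g = (SUP x\<in>X. dY (f x) (g x))"

lemma quasimetric_space_SMap:
  assumes "quasimetric_space Y dY"
  shows "quasimetric_space (SMap X dX Y dY) (SMap_dist X dY)"
  unfolding quasimetric_space_def
proof (intro conjI ballI)
  fix f g h
  assume fgh: "f \<in> SMap X dX Y dY" "g \<in> SMap X dX Y dY" "h \<in> SMap X dX Y dY"
  show "SMap_dist X dY f h \<le> SMap_dist X dY f g + SMap_dist X dY g h"
    unfolding SMap_dist_def
  proof (rule SUP_least)
    fix x assume x: "x \<in> X"
    then have "f x \<in> Y" "g x \<in> Y" "h x \<in> Y" using fgh by (auto simp: SMap_def)
    then have "dY (f x) (h x) \<le> dY (f x) (g x) + dY (g x) (h x)"
      using assms by (auto simp: quasimetric_space_def)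
    also have "\<dots> \<le> (SUP x\<in>X. dY (f x) (g x)) + (SUP x\<in>X. dY (g x) (h x))"
      using x by (intro add_mono SUP_upper)
    finally show "dY (f x) (h x) \<le> \<dots>" .
  qed
next
  fix f g
  assume fg: "f \<in> SMap X dX Y dY" "g \<in> SMap X dX Y dY"
  have "SMap_dist X dY f g = 0 \<longleftrightarrow> (\<forall>x\<in>X. dY (f x) (g x) = 0)"
    by (simp add: SMap_dist_def SUP_eq_iff bot_ennreal[symmetric] SUP_bot_conv)
  also have "\<dots> \<longleftrightarrow> (\<forall>x\<in>X. f x = g x)"
    using fg assms by (auto simp: quasimetric_space_def SMap_def PiE_def Pi_def)
  also have "\<dots> \<longleftrightarrow> f = g"
    using fg by (auto simp: SMap_def PiE_def intro: extensionalityI)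
  finally show "SMap_dist X dY f g = 0 \<longleftrightarrow> f = g" .
qed

abbreviation id_map :: "'a set \<Rightarrow> 'a \<Rightarrow> 'a" where
  "id_map X \<equiv> (\<lambda>x\<in>X. x)"

definition isometry ::
  "'a set \<Rightarrow> ('a \<Rightarrow> 'a \<Rightarrow> ennreal) \<Rightarrow> 'b set \<Rightarrow> ('b \<Rightarrow> 'b \<Rightarrow> ennreal) \<Rightarrow> ('a \<Rightarrow> 'b) \<Rightarrow> bool" where
  "isometry X dX Y dY f \<longleftrightarrow>
     bij_betw f X Y \<and> (\<forall>x\<in>X. \<forall>x'\<in>X. dY (f x) (f x') = dX x x')"

definition isometric ::
  "'a set \<Rightarrow> ('a \<Rightarrow> 'a \<Rightarrow> ennreal) \<Rightarrow> 'b set \<Rightarrow> ('b \<Rightarrow> 'b \<Rightarrow> ennreal) \<Rightarrow> bool" where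
  "isometric X dX Y dY \<longleftrightarrow> (\<exists>f. isometry X dX Y dY f)"

(* The smallest equivalence relation on X relating all points with d x x' \<le> r. *)
definition sim_rel :: "real \<Rightarrow> 'a set \<Rightarrow> ('a \<Rightarrow> 'a \<Rightarrow> ennreal) \<Rightarrow> ('a \<times> 'a) set" where
  "sim_rel r X d =
     \<Inter> {R. equiv X R \<and> (\<forall>x\<in>X. \<forall>x'\<in>X. d x x' \<le> ennreal r \<longrightarrow> (x, x') \<in> R)}"

lemma sim_rel_smallest:
  shows "equiv X (sim_rel r X d)"
    and "\<lbrakk>x \<in> X; x' \<in> X; d x x' \<le> ennreal r\<rbrakk> \<Longrightarrow> (x, x') \<in> sim_rel r X d"
    and "\<lbrakk>equiv X R; \<And>x x'. \<lbrakk>x \<in> X; x' \<in> X; d x x' \<le> ennreal r\<rbrakk> \<Longrightarrow> (x, x') \<in> R\<rbrakk>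
           \<Longrightarrow> sim_rel r X d \<subseteq> R"
proof -
  let ?E = "{R. equiv X R \<and> (\<forall>x\<in>X. \<forall>x'\<in>X. d x x' \<le> ennreal r \<longrightarrow> (x, x') \<in> R)}"
  have all: "X \<times> X \<in> ?E"
    by (auto simp: equiv_def refl_on_def sym_def trans_def)
  show "equiv X (sim_rel r X d)"
  proof (rule equivI)
    show "sim_rel r X d \<subseteq> X \<times> X" using all unfolding sim_rel_def by blast
    show "refl_on X (sim_rel r X d)" by (auto simp: sim_rel_def equiv_def refl_on_def)
    show "sym (sim_rel r X d)" by (auto simp: sim_rel_def equiv_def intro!: symI dest: symD)
    show "trans (sim_rel r X d)"
      unfolding sim_rel_def equiv_def by (rule transI) (blast dest: transD)
  qed
  show "(x, x') \<in> sim_rel r X d" if "x \<in> X" "x' \<in> X" "d x x' \<le> ennreal r"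
    using that by (auto simp: sim_rel_def)
  show "sim_rel r X d \<subseteq> R"
    if "equiv X R" "\<And>x x'. \<lbrakk>x \<in> X; x' \<in> X; d x x' \<le> ennreal r\<rbrakk> \<Longrightarrow> (x, x') \<in> R"
    unfolding sim_rel_def by (rule Inter_lower) (use that in blast)
qed

definition homotopic ::
  "real \<Rightarrow> 'a set \<Rightarrow> ('a \<Rightarrow> 'a \<Rightarrow> ennreal) \<Rightarrow> 'b set \<Rightarrow> ('b \<Rightarrow> 'b \<Rightarrow> ennreal)
    \<Rightarrow> ('a \<Rightarrow> 'b) \<Rightarrow> ('a \<Rightarrow> 'b) \<Rightarrow> bool" where
  "homotopic r X dX Y dY f g \<longleftrightarrow> (f, g) \<in> sim_rel r (SMap X dX Y dY) (SMap_dist X dY)"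

definition homotopy_equivalence ::
  "real \<Rightarrow> 'a set \<Rightarrow> ('a \<Rightarrow> 'a \<Rightarrow> ennreal) \<Rightarrow> 'b set \<Rightarrow> ('b \<Rightarrow> 'b \<Rightarrow> ennreal)
    \<Rightarrow> ('a \<Rightarrow> 'b) \<Rightarrow> bool" where
  "homotopy_equivalence r X dX Y dY f \<longleftrightarrow>
     f \<in> SMap X dX Y dY \<and>
     (\<exists>g \<in> SMap Y dY X dX.
        homotopic r X dX X dX (compose X g f) (id_map X) \<and>
        homotopic r Y dY Y dY (compose Y f g) (id_map Y))"

definition homotopy_equivalent ::
  "real \<Rightarrow> 'a set \<Rightarrow> ('a \<Rightarrow> 'a \<Rightarrow> ennreal) \<Rightarrow> 'b set \<Rightarrow> ('b \<Rightarrow> 'b \<Rightarrow> ennreal) \<Rightarrow> bool" where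
  "homotopy_equivalent r X dX Y dY \<longleftrightarrow> (\<exists>f. homotopy_equivalence r X dX Y dY f)"

(* id_map A, viewed as a map from A to X, is the inclusion of A. *)
definition retraction_map ::
  "'a set \<Rightarrow> ('a \<Rightarrow> 'a \<Rightarrow> ennreal) \<Rightarrow> 'a set \<Rightarrow> ('a \<Rightarrow> 'a) \<Rightarrow> bool" where
  "retraction_map X d A \<rho> \<longleftrightarrow>
     \<rho> \<in> SMap X d A d \<and> compose A \<rho> (id_map A) = id_map A"

definition deformation_retract ::
  "real \<Rightarrow> 'a set \<Rightarrow> ('a \<Rightarrow> 'a \<Rightarrow> ennreal) \<Rightarrow> 'a set \<Rightarrow> bool" where
  "deformation_retract r X d A \<longleftrightarrow>
     A \<subseteq> X \<and>
     (\<exists>\<rho>. retraction_map X d A \<rho> \<and>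
          homotopic r X d X d (compose X (id_map A) \<rho>) (id_map X))"

definition minimal :: "real \<Rightarrow> 'a set \<Rightarrow> ('a \<Rightarrow> 'a \<Rightarrow> ennreal) \<Rightarrow> bool" where
  "minimal r X d \<longleftrightarrow>
     finite X \<and> quasimetric_space X d \<and> \<not> (\<exists>A. A \<noteq> X \<and> deformation_retract r X d A)"

definition minimal_model ::
  "real \<Rightarrow> 'a set \<Rightarrow> ('a \<Rightarrow> 'a \<Rightarrow> ennreal) \<Rightarrow> 'b set \<Rightarrow> ('b \<Rightarrow> 'b \<Rightarrow> ennreal) \<Rightarrow> bool" where
  "minimal_model r X dX M dM \<longleftrightarrow> minimal r M dM \<and> homotopy_equivalent r X dX M dM"

end

theory Submission
  imports Defs
begin

text \<open>
  Everything rests on one rigidity fact: on an \<open>r\<close>-minimal space \<open>M\<close>, every short self-map \<open>f\<close>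
  that is \<open>r\<close>-homotopic to the identity is an isometry. Since \<open>M\<close> is finite, some power
  \<open>e = f\<^sup>k\<close> with \<open>k > 0\<close> is idempotent (\<open>idempotent_power\<close>). Composition respects
  \<open>r\<close>-homotopy, so \<open>e\<close> is again \<open>r\<close>-homotopic to the identity, and an idempotent is a retraction
  onto its image. So the image of \<open>e\<close> is an \<open>r\<close>-deformation retract, which by minimality is all
  of \<open>M\<close>; an idempotent with full image is the identity. From \<open>f\<^sup>k = 1\<close> and the shortness of all
  powers of \<open>f\<close> it follows that \<open>f\<close> is bijective and preserves distances
  (\<open>minimal_self_map_isometry\<close>).

  Given an \<open>r\<close>-homotopy equivalence \<open>f\<close> of minimal spaces with homotopy inverse \<open>g\<close>, both \<open>g f\<close>
  and \<open>f g\<close> are therefore isometries, which squeezes \<open>f\<close> itself into being one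
  (\<open>minimal_homotopy_equivalent_imp_isometric\<close>). As \<open>r\<close>-homotopy equivalence is an equivalence
  relation, this gives uniqueness of minimal models and their classification.

  For existence, deformation retracts of deformation retracts are deformation retracts, so one of
  least cardinality has no proper deformation retract; and a deformation retract is homotopy
  equivalent to the ambient space.
\<close>

section \<open>Short maps and their homotopies\<close>

lemma SMapI:
  assumes "\<And>x. x \<in> X \<Longrightarrow> f x \<in> Y" "f \<in> extensional X"
    "\<And>x x'. x \<in> X \<Longrightarrow> x' \<in> X \<Longrightarrow> dY (f x) (f x') \<le> dX x x'"
  shows "f \<in> SMap X dX Y dY"
  using assms by (auto simp: SMap_def PiE_def)

lemma SMapD:
  assumes "f \<in> SMap X dX Y dY"
  shows "x \<in> X \<Longrightarrow> f x \<in> Y" "f \<in> extensional X"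
    "x \<in> X \<Longrightarrow> x' \<in> X \<Longrightarrow> dY (f x) (f x') \<le> dX x x'"
  using assms by (auto simp: SMap_def PiE_def)

lemma id_map_SMap: "A \<subseteq> X \<Longrightarrow> id_map A \<in> SMap A d X d"
  by (rule SMapI) auto

lemma compose_SMap:
  assumes "f \<in> SMap X dX Y dY" "g \<in> SMap Y dY Z dZ"
  shows "compose X g f \<in> SMap X dX Z dZ"
  using assms
  by (intro SMapI) (auto simp: compose_def dest: SMapD intro: order_trans[OF SMapD(3) SMapD(3)])

lemma compose_id_map_left:
  assumes "f \<in> SMap X dX Y dY"
  shows "compose X (id_map Y) f = f"
  by (rule extensionalityI[of _ X]) (use SMapD[OF assms] in \<open>auto simp: compose_def\<close>)

lemma compose_id_map_right:
  assumes "f \<in> SMap X dX Y dY"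
  shows "compose X f (id_map X) = f"
  by (rule extensionalityI[of _ X]) (use SMapD[OF assms] in \<open>auto simp: compose_def\<close>)

lemma compose_assoc_SMap:
  assumes "f \<in> SMap X dX Y dY"
  shows "compose X (compose Y h g) f = compose X h (compose X g f)"
  by (rule extensionalityI[of _ X]) (use SMapD[OF assms] in \<open>auto simp: compose_def\<close>)

text \<open>
  The relation pulled back along \<open>F\<close> is an equivalence containing all pairs at distance at most
  \<open>r\<close>, so it contains the smallest such equivalence. Applied to spaces of short maps, this turns
  homotopy invariance of composition into a distance estimate.
\<close>

lemma sim_rel_short_map:
  assumes F: "\<And>x. x \<in> X \<Longrightarrow> F x \<in> Y"
    and short: "\<And>x x'. x \<in> X \<Longrightarrow> x' \<in> X \<Longrightarrow> dY (F x) (F x') \<le> dX x x'"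
    and xx': "(x, x') \<in> sim_rel r X dX"
  shows "(F x, F x') \<in> sim_rel r Y dY"
proof -
  let ?R = "{(x, x'). x \<in> X \<and> x' \<in> X \<and> (F x, F x') \<in> sim_rel r Y dY}"
  have eq: "equiv Y (sim_rel r Y dY)" by (rule sim_rel_smallest)
  have "equiv X ?R"
  proof (rule equivI)
    show "?R \<subseteq> X \<times> X" by auto
    show "refl_on X ?R" using eq F by (auto simp: equiv_def refl_on_def)
    show "sym ?R" using eq by (auto simp: equiv_def intro!: symI dest: symD)
    show "trans ?R" using eq by (auto simp: equiv_def intro!: transI dest: transD)
  qed
  moreover have "(y, y') \<in> ?R" if "y \<in> X" "y' \<in> X" "dX y y' \<le> ennreal r" for y y'
    using that F short by (auto intro!: sim_rel_smallest(2) intro: order_trans)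
  ultimately have "sim_rel r X dX \<subseteq> ?R" by (rule sim_rel_smallest(3))
  then show ?thesis using xx' by blast
qed

lemma homotopic_refl: "f \<in> SMap X dX Y dY \<Longrightarrow> homotopic r X dX Y dY f f"
  unfolding homotopic_def by (meson equivE refl_onD sim_rel_smallest(1))

lemma homotopic_trans:
  "homotopic r X dX Y dY f g \<Longrightarrow> homotopic r X dX Y dY g h \<Longrightarrow> homotopic r X dX Y dY f h"
  unfolding homotopic_def by (metis equivE sim_rel_smallest(1) transD)

lemma homotopic_compose_left:
  assumes g: "g \<in> SMap Y dY Z dZ" and h: "homotopic r X dX Y dY f f'"
  shows "homotopic r X dX Z dZ (compose X g f) (compose X g f')"
  using h unfolding homotopic_def
proof (rule sim_rel_short_map[rotated 2])
  fix f f' assume f: "f \<in> SMap X dX Y dY" "f' \<in> SMap X dX Y dY"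
  show "compose X g f \<in> SMap X dX Z dZ" using f(1) g by (rule compose_SMap)
  show "SMap_dist X dZ (compose X g f) (compose X g f') \<le> SMap_dist X dY f f'"
    unfolding SMap_dist_def
  proof (rule SUP_mono, rule bexI)
    show "dZ (compose X g f x) (compose X g f' x) \<le> dY (f x) (f' x)" if "x \<in> X" for x
      using that SMapD(3)[OF g] SMapD(1)[OF f(1)] SMapD(1)[OF f(2)] by (simp add: compose_eq)
  qed
qed

lemma homotopic_compose_right:
  assumes f: "f \<in> SMap X dX Y dY" and h: "homotopic r Y dY Z dZ g g'"
  shows "homotopic r X dX Z dZ (compose X g f) (compose X g' f)"
  using h unfolding homotopic_def
proof (rule sim_rel_short_map[where F = "\<lambda>g. compose X g f", rotated 2])
  fix g g' assume g: "g \<in> SMap Y dY Z dZ" "g' \<in> SMap Y dY Z dZ"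
  show "compose X g f \<in> SMap X dX Z dZ" using f g(1) by (rule compose_SMap)
  show "SMap_dist X dZ (compose X g f) (compose X g' f) \<le> SMap_dist Y dZ g g'"
    unfolding SMap_dist_def
    by (rule SUP_mono) (use SMapD[OF f] in \<open>auto simp: compose_def\<close>)
qed

section \<open>Homotopy equivalence\<close>

lemma homotopy_equivalent_sym:
  "homotopy_equivalent r X dX Y dY \<Longrightarrow> homotopy_equivalent r Y dY X dX"
  unfolding homotopy_equivalent_def homotopy_equivalence_def by blast

text \<open>
  One half of transitivity: in the composite \<open>g' g f f'\<close> the inner round trip \<open>g f\<close> contracts to
  the identity, and then so does the outer one. The other half is this lemma with the roles of the
  maps exchanged.
\<close>

lemma homotopic_nested_inverse:
  assumes f: "f \<in> SMap X dX Y dY" and g: "g \<in> SMap Y dY X dX"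
    and f': "f' \<in> SMap Y dY Z dZ" and g': "g' \<in> SMap Z dZ Y dY"
    and gf: "homotopic r X dX X dX (compose X g f) (id_map X)"
    and g'f': "homotopic r Y dY Y dY (compose Y g' f') (id_map Y)"
  shows "homotopic r X dX X dX (compose X (compose Z g g') (compose X f' f)) (id_map X)"
proof -
  have "compose X (compose Z g g') (compose X f' f) = compose X g (compose X (compose Y g' f') f)"
    by (simp add: compose_assoc_SMap[OF f] compose_assoc_SMap[OF compose_SMap[OF f f']])
  moreover have "homotopic r X dX X dX \<dots> (compose X g (compose X (id_map Y) f))"
    by (intro homotopic_compose_left[OF g] homotopic_compose_right[OF f] g'f')
  ultimately show ?thesis
    using gf by (simp add: compose_id_map_left[OF f] homotopic_trans)
qed

lemma homotopy_equivalent_trans: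
  assumes "homotopy_equivalent r X dX Y dY" "homotopy_equivalent r Y dY Z dZ"
  shows "homotopy_equivalent r X dX Z dZ"
proof -
  obtain f g where f: "f \<in> SMap X dX Y dY" "g \<in> SMap Y dY X dX"
    "homotopic r X dX X dX (compose X g f) (id_map X)"
    "homotopic r Y dY Y dY (compose Y f g) (id_map Y)"
    using assms(1) unfolding homotopy_equivalent_def homotopy_equivalence_def by blast
  obtain f' g' where f': "f' \<in> SMap Y dY Z dZ" "g' \<in> SMap Z dZ Y dY"
    "homotopic r Y dY Y dY (compose Y g' f') (id_map Y)"
    "homotopic r Z dZ Z dZ (compose Z f' g') (id_map Z)"
    using assms(2) unfolding homotopy_equivalent_def homotopy_equivalence_def by blast
  have "homotopy_equivalence r X dX Z dZ (compose X f' f)"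
    unfolding homotopy_equivalence_def
    using compose_SMap[OF f(1) f'(1)] compose_SMap[OF f'(2) f(2)]
      homotopic_nested_inverse[OF f(1,2) f'(1,2) f(3) f'(3)]
      homotopic_nested_inverse[OF f'(2,1) f(2,1) f'(4) f(4)]
    by blast
  then show ?thesis unfolding homotopy_equivalent_def by blast
qed

lemma isometric_imp_homotopy_equivalent:
  assumes "isometric X dX Y dY"
  shows "homotopy_equivalent r X dX Y dY"
proof -
  obtain f where bij: "bij_betw f X Y" and dist: "\<forall>x\<in>X. \<forall>x'\<in>X. dY (f x) (f x') = dX x x'"
    using assms unfolding isometric_def isometry_def by blast
  define g where "g = inv_into X f"
  have g: "g y \<in> X" "f (g y) = y" if "y \<in> Y" for y
    using that bij by (auto simp: g_def bij_betw_def inv_into_into f_inv_into_f)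
  have gf: "g (f x) = x" if "x \<in> X" for x
    using that bij by (auto simp: g_def bij_betw_def)
  have f: "f x \<in> Y" if "x \<in> X" for x using that bij by (auto simp: bij_betw_def)
  have fS: "restrict f X \<in> SMap X dX Y dY" by (rule SMapI) (use f dist in auto)
  have gS: "restrict g Y \<in> SMap Y dY X dX"
  proof (rule SMapI)
    show "dX (restrict g Y y) (restrict g Y y') \<le> dY y y'" if "y \<in> Y" "y' \<in> Y" for y y'
      using dist[rule_format, of "g y" "g y'"] g that by simp
  qed (use g in auto)
  have "compose X (restrict g Y) (restrict f X) = id_map X"
    "compose Y (restrict f X) (restrict g Y) = id_map Y"
    using f g gf by (auto simp: compose_def restrict_def fun_eq_iff)
  then have "homotopy_equivalence r X dX Y dY (restrict f X)"
    unfolding homotopy_equivalence_def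
    using fS gS homotopic_refl[OF id_map_SMap[OF subset_refl]] by metis
  then show ?thesis unfolding homotopy_equivalent_def by blast
qed

section \<open>Deformation retracts\<close>

lemma deformation_retract_iff:
  "deformation_retract r X d A \<longleftrightarrow>
     A \<subseteq> X \<and> (\<exists>\<rho> \<in> SMap X d A d. (\<forall>a\<in>A. \<rho> a = a) \<and> homotopic r X d X d \<rho> (id_map X))"
proof -
  have "compose A \<rho> (id_map A) = id_map A \<longleftrightarrow> (\<forall>a\<in>A. \<rho> a = a)" for \<rho>
    by (auto simp: compose_def restrict_def fun_eq_iff)
  then show ?thesis
    unfolding deformation_retract_def retraction_map_def by (auto simp: compose_id_map_left)
qed

lemma deformation_retract_refl: "deformation_retract r X d X"
  unfolding deformation_retract_iff
  by (intro conjI subset_refl bexI[of _ "id_map X"] homotopic_refl id_map_SMap) simp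

lemma deformation_retract_trans:
  assumes "deformation_retract r X d A" "deformation_retract r A d B"
  shows "deformation_retract r X d B"
proof -
  obtain \<rho> where A: "A \<subseteq> X" and \<rho>: "\<rho> \<in> SMap X d A d" "\<forall>a\<in>A. \<rho> a = a"
    "homotopic r X d X d \<rho> (id_map X)"
    using assms(1) unfolding deformation_retract_iff by blast
  obtain \<sigma> where B: "B \<subseteq> A" and \<sigma>: "\<sigma> \<in> SMap A d B d" "\<forall>b\<in>B. \<sigma> b = b"
    "homotopic r A d A d \<sigma> (id_map A)"
    using assms(2) unfolding deformation_retract_iff by blast
  let ?\<tau> = "compose X \<sigma> \<rho>"
  have \<tau>: "?\<tau> \<in> SMap X d B d" using \<rho>(1) \<sigma>(1) by (rule compose_SMap)
  have fixed: "\<forall>b\<in>B. ?\<tau> b = b" using A B \<rho>(2) \<sigma>(2) by (auto simp: compose_def)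
  have "homotopic r X d A d ?\<tau> (compose X (id_map A) \<rho>)"
    using \<rho>(1) \<sigma>(3) by (rule homotopic_compose_right)
  then have "homotopic r X d A d ?\<tau> \<rho>" by (simp add: compose_id_map_left[OF \<rho>(1)])
  \<comment> \<open>This homotopy runs through maps into \<open>A\<close>; the inclusion carries it to maps into \<open>X\<close>.\<close>
  then have "homotopic r X d X d (compose X (id_map A) ?\<tau>) (compose X (id_map A) \<rho>)"
    by (rule homotopic_compose_left[OF id_map_SMap[OF A]])
  moreover have "?\<tau> \<in> SMap X d A d" using \<tau> B by (auto simp: SMap_def)
  ultimately have "homotopic r X d X d ?\<tau> \<rho>"
    by (simp only: compose_id_map_left[OF \<rho>(1)] compose_id_map_left[of ?\<tau>])
  then have "homotopic r X d X d ?\<tau> (id_map X)" using \<rho>(3) by (rule homotopic_trans)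
  then show ?thesis using A B \<tau> fixed unfolding deformation_retract_iff by blast
qed

lemma deformation_retract_homotopy_equivalent:
  assumes "deformation_retract r X d A"
  shows "homotopy_equivalent r X d A d"
proof -
  obtain \<rho> where A: "A \<subseteq> X" and \<rho>: "retraction_map X d A \<rho>"
    "homotopic r X d X d (compose X (id_map A) \<rho>) (id_map X)"
    using assms unfolding deformation_retract_def by blast
  have "homotopy_equivalence r X d A d \<rho>"
    unfolding homotopy_equivalence_def
    using \<rho> id_map_SMap[OF A, of d] homotopic_refl[OF id_map_SMap[OF subset_refl], of r A d]
    by (auto simp: retraction_map_def)
  then show ?thesis unfolding homotopy_equivalent_def by blast
qed

section \<open>Rigidity of minimal spaces\<close>

text \<open>
  By pigeonhole the powers of \<open>f\<close> repeat, \<open>f\<^sup>i = f\<^sup>j\<close> with \<open>i < j\<close>, so from the exponent \<open>i\<close> on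
  they are periodic with period \<open>p = j - i\<close>. Any exponent \<open>k \<ge> i\<close> divisible by \<open>p\<close> then satisfies
  \<open>f\<^sup>k\<^sup>+\<^sup>k = f\<^sup>k\<close>.
\<close>

lemma idempotent_power:
  assumes "finite X" and f: "\<And>x. x \<in> X \<Longrightarrow> f x \<in> X"
  obtains k where "k > 0" "\<And>x. x \<in> X \<Longrightarrow> (f ^^ k) ((f ^^ k) x) = (f ^^ k) x"
proof -
  have fX: "(f ^^ n) x \<in> X" if "x \<in> X" for n x
    using that f by (induction n) auto
  have add: "(f ^^ m) ((f ^^ n) x) = (f ^^ (m + n)) x" for m n x
    by (simp add: funpow_add)
  have "range (\<lambda>n. restrict (f ^^ n) X) \<subseteq> X \<rightarrow>\<^sub>E X"
    using fX by (intro image_subsetI restrict_PiE_iff[THEN iffD2]) blast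
  then have "finite (range (\<lambda>n. restrict (f ^^ n) X))"
    by (rule finite_subset) (simp add: finite_PiE \<open>finite X\<close>)
  then have "\<not> inj (\<lambda>n. restrict (f ^^ n) X)" using finite_imageD infinite_UNIV_nat by blast
  then obtain i j where "i < j" and rep: "restrict (f ^^ i) X = restrict (f ^^ j) X"
    unfolding inj_def by (metis nat_neq_iff)
  define p where "p = j - i"
  have p: "p > 0" "j = i + p" using \<open>i < j\<close> by (auto simp: p_def)
  have period: "(f ^^ (m * p + i)) x = (f ^^ i) x" if "x \<in> X" for m x
  proof (induction m)
    case (Suc m)
    have "(f ^^ (Suc m * p + i)) x = (f ^^ (m * p)) ((f ^^ j) x)"
      by (simp add: add p(2) ac_simps)
    also have "(f ^^ j) x = (f ^^ i) x" using rep that by (metis restrict_apply')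
    finally show ?case using Suc by (simp only: add)
  qed simp
  define k where "k = (i + 1) * p"
  have "k \<ge> i" using p(1) mult_le_mono[of i "i + 1" 1 p] by (simp add: k_def)
  show thesis
  proof (rule that)
    show "k > 0" using p(1) by (simp add: k_def)
    fix x assume x: "x \<in> X"
    have "(f ^^ k) ((f ^^ k) x) = (f ^^ (k - i)) ((f ^^ (k + i)) x)"
      using \<open>k \<ge> i\<close> by (simp add: add)
    also have "\<dots> = (f ^^ (k - i)) ((f ^^ i) x)" unfolding k_def by (simp only: period[OF x])
    also have "\<dots> = (f ^^ k) x"
      using \<open>k \<ge> i\<close> by (simp add: add)
    finally show "(f ^^ k) ((f ^^ k) x) = (f ^^ k) x" .
  qed
qed

lemma funpow_SMap:
  assumes f: "f \<in> SMap X d X d"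
  shows "restrict (f ^^ n) X \<in> SMap X d X d"
proof (induction n)
  case 0
  have "restrict (f ^^ 0) X = id_map X" by auto
  then show ?case using id_map_SMap[OF subset_refl, of X d] by (simp only:)
next
  case (Suc n)
  have "restrict (f ^^ Suc n) X = compose X f (restrict (f ^^ n) X)"
    by (auto simp: compose_def restrict_def)
  then show ?case using compose_SMap[OF Suc f] by (simp only:)
qed

lemma funpow_homotopic_id:
  assumes f: "f \<in> SMap X d X d" and h: "homotopic r X d X d f (id_map X)"
  shows "homotopic r X d X d (restrict (f ^^ n) X) (id_map X)"
proof (induction n)
  case 0
  have "restrict (f ^^ 0) X = id_map X" by auto
  then show ?case using homotopic_refl[OF id_map_SMap[OF subset_refl], of r X d] by (simp only:)
next
  case (Suc n)
  have "restrict (f ^^ Suc n) X = compose X f (restrict (f ^^ n) X)"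
    by (auto simp: compose_def restrict_def)
  moreover have "homotopic r X d X d \<dots> (compose X f (id_map X))"
    using f Suc by (rule homotopic_compose_left)
  ultimately have "homotopic r X d X d (restrict (f ^^ Suc n) X) f"
    by (simp only: compose_id_map_right[OF f])
  then show ?case using h by (rule homotopic_trans)
qed

lemma minimal_self_map_isometry:
  assumes M: "minimal r M d" and f: "f \<in> SMap M d M d"
    and h: "homotopic r M d M d f (id_map M)"
  shows "isometry M d M d f"
proof -
  have fin: "finite M" using M by (simp add: minimal_def)
  obtain k where k: "k > 0" "\<And>x. x \<in> M \<Longrightarrow> (f ^^ k) ((f ^^ k) x) = (f ^^ k) x"
    using idempotent_power[OF fin, of f] SMapD(1)[OF f] by blast
  have pow: "(f ^^ n) x \<in> M" "d ((f ^^ n) x) ((f ^^ n) y) \<le> d x y" if "x \<in> M" "y \<in> M" for n x y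
    using SMapD(1)[OF funpow_SMap[OF f, of n], of x] SMapD(3)[OF funpow_SMap[OF f, of n], of x y]
      that
    by auto
  let ?e = "restrict (f ^^ k) M"
  have "?e \<in> SMap M d (?e ` M) d" by (rule SMapI) (use pow in auto)
  then have "deformation_retract r M d (?e ` M)"
    unfolding deformation_retract_iff using funpow_homotopic_id[OF f h, of k] k(2) pow(1)
    by (intro conjI bexI[of _ ?e]) auto
  then have image: "?e ` M = M" using M unfolding minimal_def by blast
  have id: "(f ^^ k) x = x" if "x \<in> M" for x
  proof -
    from that obtain y where "y \<in> M" "x = (f ^^ k) y" using image by force
    then show ?thesis using k(2) by simp
  qed
  \<comment> \<open>So \<open>f\<^sup>k\<^sup>-\<^sup>1\<close> is a short left inverse of \<open>f\<close>.\<close>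
  have left: "(f ^^ (k - 1)) (f x) = x" if "x \<in> M" for x
    using id[OF that] k(1) by (metis Suc_diff_1 comp_apply funpow_Suc_right)
  have "inj_on f M" using left by (rule inj_on_inverseI)
  then have "bij_betw f M M"
    using endo_inj_surj[OF fin] SMapD(1)[OF f] by (auto simp: bij_betw_def)
  moreover have "d (f x) (f y) = d x y" if "x \<in> M" "y \<in> M" for x y
    using pow(2)[of "f x" "f y" "k - 1"] left SMapD[OF f] that by (simp add: order_antisym)
  ultimately show ?thesis by (simp add: isometry_def)
qed

text \<open>
  Both round trips being isometries makes \<open>f\<close> bijective, and forces equality in
  \<open>d(x, y) = d(g f x, g f y) \<le> d(f x, f y) \<le> d(x, y)\<close>.
\<close>

lemma minimal_homotopy_equivalent_imp_isometric:
  assumes M: "minimal r M dM" and N: "minimal r N dN"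
    and "homotopy_equivalent r M dM N dN"
  shows "isometric M dM N dN"
proof -
  obtain f g where f: "f \<in> SMap M dM N dN" and g: "g \<in> SMap N dN M dM"
    and gf: "homotopic r M dM M dM (compose M g f) (id_map M)"
    and fg: "homotopic r N dN N dN (compose N f g) (id_map N)"
    using assms(3) unfolding homotopy_equivalent_def homotopy_equivalence_def by blast
  have igf: "isometry M dM M dM (compose M g f)"
    using M compose_SMap[OF f g] gf by (rule minimal_self_map_isometry)
  have ifg: "isometry N dN N dN (compose N f g)"
    using N compose_SMap[OF g f] fg by (rule minimal_self_map_isometry)
  have "inj_on f M"
    using igf unfolding isometry_def bij_betw_def inj_on_def by (simp add: compose_eq)
  moreover have "f ` M = N"
  proof
    show "f ` M \<subseteq> N" using SMapD(1)[OF f] by blast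
    have "N = compose N f g ` N" using ifg by (simp add: isometry_def bij_betw_def)
    also have "\<dots> \<subseteq> f ` M" using SMapD(1)[OF g] by (auto simp: compose_eq)
    finally show "N \<subseteq> f ` M" .
  qed
  moreover have "dN (f x) (f y) = dM x y" if "x \<in> M" "y \<in> M" for x y
  proof (rule order_antisym)
    show "dN (f x) (f y) \<le> dM x y" using f that by (rule SMapD)
    have "dM x y = dM (g (f x)) (g (f y))"
      using igf that by (simp add: isometry_def compose_eq)
    also have "\<dots> \<le> dN (f x) (f y)" using SMapD[OF f] SMapD[OF g] that by blast
    finally show "dM x y \<le> dN (f x) (f y)" .
  qed
  ultimately have "isometry M dM N dN f" by (simp add: isometry_def bij_betw_def)
  then show ?thesis unfolding isometric_def by blast
qed

section \<open>Minimal models\<close>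

lemma ex_minimal_deformation_retract:
  assumes "finite X" "quasimetric_space X d"
  obtains A where "deformation_retract r X d A" "minimal r A d"
proof -
  obtain A where A: "deformation_retract r X d A"
    and least: "\<And>B. deformation_retract r X d B \<Longrightarrow> card A \<le> card B"
    using ex_has_least_nat[of "deformation_retract r X d", OF deformation_retract_refl, of card]
    by blast
  have "A \<subseteq> X" using A by (simp add: deformation_retract_def)
  then have fin: "finite A" and qm: "quasimetric_space A d"
    using assms by (auto simp: finite_subset quasimetric_space_def subset_iff)
  have "B = A" if B: "deformation_retract r A d B" for B
    using fin least[OF deformation_retract_trans[OF A B]] B
    by (simp add: deformation_retract_def card_seteq)
  then show thesis using that[OF A] fin qm by (auto simp: minimal_def)
qed

lemma minimal_models_isometric:
  assumes "minimal_model r X dX M dM" "minimal_model r Y dY N dN"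
    and "homotopy_equivalent r X dX Y dY"
  shows "isometric M dM N dN"
  using assms unfolding minimal_model_def
  by (meson minimal_homotopy_equivalent_imp_isometric homotopy_equivalent_sym
      homotopy_equivalent_trans)

lemma isometric_minimal_models_imp_homotopy_equivalent:
  assumes "minimal_model r X dX M dM" "minimal_model r Y dY N dN" "isometric M dM N dN"
  shows "homotopy_equivalent r X dX Y dY"
  using assms unfolding minimal_model_def
  by (meson isometric_imp_homotopy_equivalent homotopy_equivalent_sym homotopy_equivalent_trans)

lemma ex_minimal_model_deformation_retract:
  assumes "finite X" "quasimetric_space X d"
  shows "\<exists>A. A \<subseteq> X \<and> deformation_retract r X d A \<and> minimal_model r X d A d"
proof -
  obtain A where "deformation_retract r X d A" "minimal r A d"
    using assms by (rule ex_minimal_deformation_retract)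
  moreover from this have "A \<subseteq> X" by (simp add: deformation_retract_def)
  ultimately show ?thesis
    using deformation_retract_homotopy_equivalent unfolding minimal_model_def by blast
qed

theorem theorem2p5:
  fixes r :: real
  assumes "0 \<le> r"
  shows
    "(\<forall>(X :: 'a set) dX. finite X \<and> quasimetric_space X dX \<longrightarrow>
        (\<exists>(M :: 'a set) dM. minimal_model r X dX M dM) \<and>
        (\<forall>(M :: 'b set) dM (N :: 'c set) dN.
           minimal_model r X dX M dM \<and> minimal_model r X dX N dN \<longrightarrow> isometric M dM N dN)) \<and>
     (\<forall>(X :: 'a set) dX (Y :: 'd set) dY (M :: 'b set) dM (N :: 'c set) dN.
        finite X \<and> quasimetric_space X dX \<and> finite Y \<and> quasimetric_space Y dY \<and>
        minimal_model r X dX M dM \<and> minimal_model r Y dY N dN \<longrightarrow>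
        (homotopy_equivalent r X dX Y dY \<longleftrightarrow> isometric M dM N dN)) \<and>
     (\<forall>(X :: 'a set) dX. finite X \<and> quasimetric_space X dX \<longrightarrow>
        (\<exists>A. A \<subseteq> X \<and> deformation_retract r X dX A \<and> minimal_model r X dX A dX))"
proof (intro conjI allI impI; (elim conjE)?)
  fix X :: "'a set" and dX
  assume X: "finite X" "quasimetric_space X dX"
  show "\<exists>(M :: 'a set) dM. minimal_model r X dX M dM"
    using ex_minimal_model_deformation_retract[OF X] by blast
  show "\<exists>A. A \<subseteq> X \<and> deformation_retract r X dX A \<and> minimal_model r X dX A dX"
    using X by (rule ex_minimal_model_deformation_retract)
next
  fix X :: "'a set" and dX and M :: "'b set" and dM and N :: "'c set" and dN
  assume "minimal_model r X dX M dM" "minimal_model r X dX N dN"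
  moreover have "homotopy_equivalent r X dX X dX"
    by (rule deformation_retract_homotopy_equivalent[OF deformation_retract_refl])
  ultimately show "isometric M dM N dN" by (rule minimal_models_isometric)
next
  fix X :: "'a set" and dX and Y :: "'d set" and dY
    and M :: "'b set" and dM and N :: "'c set" and dN
  assume "minimal_model r X dX M dM" "minimal_model r Y dY N dN"
  then show "homotopy_equivalent r X dX Y dY \<longleftrightarrow> isometric M dM N dN"
    using minimal_models_isometric isometric_minimal_models_imp_homotopy_equivalent by blast
qed

end
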